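(* Let $X$ be a normed space, let $\theta=(k_r)$ be a lacunary sequence and let $f$ be a modulus function. Then $N_\theta^f\subset S_\theta^f$.
   Context: A modulus function is a function $f:\mathbb{R}^+\to\mathbb{R}^+$ (with $\mathbb{R}^+=[0,\infty)$) such that: (1) $f(x)=0$ if and only if $x=0$; (2) $f(x+y)\le f(x)+f(y)$ for all $x,y\in\mathbb{R}^+$; (3) $f$ is increasing ($x\le y$ implies $f(x)\le f(y)$); (4) $f$ is continuous from the right at $0$. All modulus functions are assumed to be unbounded. A lacunary sequence is a (strictly) increasing sequence $\theta=(k_r)_{r\ge 0}$ of natural numbers with $k_0=0$ such that $h_r:=k_r-k_{r-1}\to\infty$ as $r\to\infty$. Put $I_r=(k_{r-1},k_r]\cap\mathbb{N}$ for $r\ge1$. For a normed space $(X,\|\cdot\|)$, with $\#$ denoting cardinality: - $N_\theta^f$ (lacunary $f$-strong Cesàro convergent sequences) is the set of sequences $(x_n)_{n\ge1}$ in $X$ for which there is $L\in X$ with $\lim_{r\to\infty}\frac{1}{f(h_r)}f\left(\sum_{k\in I_r}\|x_k-L\|\right)=0$. - $S_\theta^f$ (lacunary $f$-statistically convergent sequences) is the set of sequences $(x_n)_{n\ge1}$ in $X$ for which there is $L\in X$ such that for every $\varepsilon>0$, $\lim_{r\to\infty}\frac{1}{f(h_r)}f\left(\#\{k\in I_r:\|x_k-L\|>\varepsilon\}\right)=0$. *)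

theory Defs
  imports Complex_Main
begin

text \<open>
  A modulus function is represented by a total function on the reals of which only the values on
  \<open>[0, \<infinity>)\<close> matter. Following the standing assumption, moduli are unbounded.
\<close>

definition modulus_function :: "(real \<Rightarrow> real) \<Rightarrow> bool" where
  "modulus_function f \<longleftrightarrow>
     (\<forall>x\<ge>0. f x \<ge> 0) \<and>
     (\<forall>x\<ge>0. f x = 0 \<longleftrightarrow> x = 0) \<and>
     (\<forall>x\<ge>0. \<forall>y\<ge>0. f (x + y) \<le> f x + f y) \<and>
     mono_on {0..} f \<and>
     continuous (at_right 0) f \<and>
     \<not> bdd_above (f ` {0..})"

text \<open>
  The block lengths and blocks are meant for \<open>r \<ge> 1\<close>. At \<open>r = 0\<close> truncated subtraction gives the
  length 0 and the empty block, which is irrelevant for limits as \<open>r\<close> tends to infinity.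
\<close>

definition block_length :: "(nat \<Rightarrow> nat) \<Rightarrow> nat \<Rightarrow> nat" where
  "block_length \<theta> r = \<theta> r - \<theta> (r - 1)"

definition block :: "(nat \<Rightarrow> nat) \<Rightarrow> nat \<Rightarrow> nat set" where
  "block \<theta> r = {\<theta> (r - 1)<..\<theta> r}"

definition lacunary :: "(nat \<Rightarrow> nat) \<Rightarrow> bool" where
  "lacunary \<theta> \<longleftrightarrow>
     strict_mono \<theta> \<and> \<theta> 0 = 0 \<and> filterlim (block_length \<theta>) at_top sequentially"

text \<open>
  Sequences \<open>(x\<^sub>n)\<close> with \<open>n \<ge> 1\<close> are functions on \<^typ>\<open>nat\<close> whose value at 0 is
  ignored: no block contains 0.
\<close>

definition lacunary_strong_Cesaro ::
  "(nat \<Rightarrow> nat) \<Rightarrow> (real \<Rightarrow> real) \<Rightarrow> (nat \<Rightarrow> 'a::real_normed_vector) set" where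
  "lacunary_strong_Cesaro \<theta> f =
     {x. \<exists>L. (\<lambda>r. 1 / f (real (block_length \<theta> r)) * f (\<Sum>k\<in>block \<theta> r. norm (x k - L)))
              \<longlonglongrightarrow> 0}"

definition lacunary_statistical ::
  "(nat \<Rightarrow> nat) \<Rightarrow> (real \<Rightarrow> real) \<Rightarrow> (nat \<Rightarrow> 'a::real_normed_vector) set" where
  "lacunary_statistical \<theta> f =
     {x. \<exists>L. \<forall>\<epsilon>>0. (\<lambda>r. 1 / f (real (block_length \<theta> r)) *
                        f (real (card {k \<in> block \<theta> r. norm (x k - L) > \<epsilon>})))
              \<longlonglongrightarrow> 0}"

end

(* If n * \<epsilon> \<ge> 1, then the number of k with norm (x k - L) > \<epsilon> is at most n times the sum of
   these norms. A modulus is monotone, and f (n * t) \<le> n * f t by subadditivity, so the statistical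
   quotient is at most n times the strong Cesaro quotient. *)
theory Submission
  imports Defs
begin

lemma modulus_function_nonneg:
  assumes "modulus_function f" "0 \<le> t"
  shows "0 \<le> f t"
  using assms by (simp add: modulus_function_def)

lemma modulus_function_mono:
  assumes "modulus_function f" "0 \<le> s" "s \<le> t"
  shows "f s \<le> f t"
  using assms unfolding modulus_function_def by (auto intro: mono_onD)

text \<open>Induction on \<open>n\<close>: subadditivity splits off one copy of \<open>t\<close> at
  a time, with all multiples staying in [0, \<infinity>), where the modulus axioms apply. Only
  natural factors are obtained this way.\<close>

lemma modulus_function_of_nat_mult_le:
  assumes f: "modulus_function f" and t: "0 \<le> t"
  shows "f (real n * t) \<le> real n * f t"
proof (induction n)
  case 0
  have "f 0 = 0"
    using f by (simp add: modulus_function_def)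
  then show ?case by simp
next
  case (Suc n)
  have "f (real n * t + t) \<le> f (real n * t) + f t"
    using f t unfolding modulus_function_def by (meson mult_nonneg_nonneg of_nat_0_le_iff)
  with Suc show ?case by (simp add: algebra_simps)
qed

text \<open>Markov's inequality for counting measure: each counted index contributes more than
  \<open>\<epsilon>\<close> to the sum, and the discarded terms are nonnegative.\<close>

lemma card_superlevel_le_sum:
  fixes g :: "'a \<Rightarrow> real"
  assumes "finite A" "\<And>k. k \<in> A \<Longrightarrow> 0 \<le> g k"
  shows "\<epsilon> * real (card {k \<in> A. \<epsilon> < g k}) \<le> sum g A"
proof -
  have "\<epsilon> * real (card {k \<in> A. \<epsilon> < g k}) = (\<Sum>k\<in>{k \<in> A. \<epsilon> < g k}. \<epsilon>)"
    by simp
  also have "\<dots> \<le> sum g {k \<in> A. \<epsilon> < g k}"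
    by (rule sum_mono) simp
  also have "\<dots> \<le> sum g A"
    using assms by (intro sum_mono2) auto
  finally show ?thesis .
qed

lemma modulus_function_card_superlevel_le:
  fixes g :: "'a \<Rightarrow> real"
  assumes f: "modulus_function f" and A: "finite A" and g: "\<And>k. k \<in> A \<Longrightarrow> 0 \<le> g k"
    and n: "1 \<le> real n * \<epsilon>"
  shows "f (real (card {k \<in> A. \<epsilon> < g k})) \<le> real n * f (sum g A)"
proof -
  let ?c = "real (card {k \<in> A. \<epsilon> < g k})"
  \<comment> \<open>The factor 1/\<open>\<epsilon>\<close> from Markov's inequality is rounded up to
    the natural number \<open>n\<close>, so that it can later be pulled out of
    \<open>f\<close>.\<close>
  have "?c \<le> real n * \<epsilon> * ?c"
    using mult_right_mono[OF n, of ?c] by simp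
  also have "\<dots> \<le> real n * sum g A"
    using mult_left_mono[OF card_superlevel_le_sum[of A g \<epsilon>, OF A g], of "real n"]
    by (simp add: mult.assoc)
  finally have "f ?c \<le> f (real n * sum g A)"
    by (intro modulus_function_mono[OF f]) simp_all
  also have "\<dots> \<le> real n * f (sum g A)"
    using g by (intro modulus_function_of_nat_mult_le[OF f] sum_nonneg)
  finally show ?thesis .
qed

theorem theorem4p1:
  fixes \<theta> :: "nat \<Rightarrow> nat" and f :: "real \<Rightarrow> real"
  assumes "lacunary \<theta>" and "modulus_function f"
  shows "(lacunary_strong_Cesaro \<theta> f :: (nat \<Rightarrow> 'a::real_normed_vector) set)
           \<subseteq> lacunary_statistical \<theta> f"
proof
  fix x :: "nat \<Rightarrow> 'a"
  assume "x \<in> lacunary_strong_Cesaro \<theta> f"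
  then obtain L where
    L: "(\<lambda>r. 1 / f (real (block_length \<theta> r)) * f (\<Sum>k\<in>block \<theta> r. norm (x k - L)))
          \<longlonglongrightarrow> 0"
    unfolding lacunary_strong_Cesaro_def by blast
  \<comment> \<open>The strong limit \<open>L\<close> serves as the statistical limit for every
    \<open>\<epsilon>\<close>.\<close>
  have "(\<lambda>r. 1 / f (real (block_length \<theta> r)) *
           f (real (card {k \<in> block \<theta> r. norm (x k - L) > \<epsilon>}))) \<longlonglongrightarrow> 0"
    (is "?q \<longlonglongrightarrow> 0") if "0 < \<epsilon>" for \<epsilon>
  proof -
    \<comment> \<open>\<open>n\<close> depends on \<open>\<epsilon>\<close> alone and not on
      \<open>r\<close>, so it is a constant factor in the limit below.\<close>
    obtain n where "1 < real n * \<epsilon>"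
      using reals_Archimedean3[OF \<open>0 < \<epsilon>\<close>] by blast
    then have n: "1 \<le> real n * \<epsilon>" by simp
    let ?p = "\<lambda>r. real n * (1 / f (real (block_length \<theta> r)) *
                f (\<Sum>k\<in>block \<theta> r. norm (x k - L)))"
    \<comment> \<open>This covers r = 0 too: there the block length is 0, so \<open>f\<close>
      vanishes and the quotient is 0 by the convention 1 / 0 = 0.\<close>
    have h: "0 \<le> 1 / f (real (block_length \<theta> r))" for r
      by (simp add: modulus_function_nonneg[OF assms(2)])
    have lower: "0 \<le> ?q r" for r
      by (intro mult_nonneg_nonneg h modulus_function_nonneg[OF assms(2)]) simp
    have upper: "?q r \<le> ?p r" for r
    proof -
      have "f (real (card {k \<in> block \<theta> r. norm (x k - L) > \<epsilon>}))
              \<le> real n * f (\<Sum>k\<in>block \<theta> r. norm (x k - L))"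
        by (rule modulus_function_card_superlevel_le[OF assms(2) _ _ n]) (simp_all add: block_def)
      from mult_left_mono[OF this h[of r]] show ?thesis
        by (simp only: mult.left_commute)
    qed
    have p: "?p \<longlonglongrightarrow> 0"
      using tendsto_mult_right_zero[OF L] .
    show ?thesis
      by (rule tendsto_sandwich[OF _ _ tendsto_const p]) (simp_all only: lower upper eventually_True)
  qed
  then show "x \<in> lacunary_statistical \<theta> f"
    unfolding lacunary_statistical_def by blast
qed

end
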